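(* Let $p=\langle H,f,f^-,c\rangle$ be a $p$-dialectical system and let $\alpha$ be a computable approximation to $H$. Let $u$ be the greatest element of $\omega\cup\{\omega\}$ such that for every $v<u$, $\lim_s r_s(v)$ exists finite (this $u$ does not depend on $\alpha$). For finite $u$ let $L(u)=\lim_s L_s(u)$, and let $L(\omega)=\bigcup_{v\in\omega}L(v)$ (where $L(v)=\lim_s L_s(v)$). If $u>0$ then, independently of the approximation, $A_p=H(L(u))$, and moreover $A_p=L(\omega)$ if $u=\omega$. If $u=0$ then, independently of the approximation, $A_p=\emptyset$.
   Context: An enumeration operator is a c.e. set $H$ of (codes of) pairs $\langle x,D\rangle$ with $x\in\omega$ and $D$ a finite subset of $\omega$; for $X\subseteq\omega$, $H(X)=\{x:\exists D\subseteq X\ \langle x,D\rangle\in H\}$. $H$ is an algebraic closure operator if $X\subseteq H(X)$ and $H(H(X))\subseteq H(X)$ for all $X$. A computable approximation $\alpha=\{H_s\}$ to $H$ is a computable sequence of finite sets of pairs (canonical indices) with $H_s\subseteq H_{s+1}$, $\bigcup_s H_s=H$; $H_s(X)$ is defined as for $H$. A $p$-dialectical system is $p=\langle H,f,f^-,c\rangle$ with $H$ an enumeration operator that is an algebraic closure operator, $H(\emptyset)\ne\emptyset$, $H(\{c\})=\omega$; $f$ a computable permutation of $\omega$ ($f_i=f(i)$); $f^-$ computable and acyclic (every set $\{x,f^-(x),f^-(f^-(x)),\dots\}$ infinite); $c\in\omega$. The $p$-dialectical procedure relative to $\alpha$: stacks $r_s(x)$ (finite strings), $m(s)$, finite sets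 $A_s$; $\rho_s(x)$ is the last entry of $r_s(x)$ when nonempty, $L_s(x)=\{\rho_s(y):y<x,\ r_s(y)\ne\langle\,\rangle\}$, $\chi_s(i)=H_s(L_s(i+1))$. Stage 0: $m(0)=0$, $r_0(0)=\langle f_0\rangle$, $r_0(x)=\langle\,\rangle$ for $x>0$, $A_0=\emptyset$. Stage $s+1$ with $m=m(s)$: (1) if no $k\le m$ has $c\in\chi_s(k)$: $m(s+1)=m+1$, $r_{s+1}(x)=r_s(x)$ for $x\le m$, $r_{s+1}(m+1)=\langle f_{m+1}\rangle$, empty above; (2) otherwise, with $z$ least such $k$: $m(s+1)=z$, $r_{s+1}(x)=r_s(x)$ for $x<z$, $r_{s+1}(z)=r_s(z)^\frown\langle f^-(\rho_s(z))\rangle$, $r_{s+1}(x)=\langle\,\rangle$ for $x>z$. Then $A_{s+1}=\bigcup_{i<m(s+1)}\chi_{s+1}(i)$. Final theses: $A_p=\{f_x:\exists t\,\forall s\ge t\ f_x\in A_s\}$. We say $\lim_s r_s(v)$ exists finite if $r_s(v)$ is constant from some stage on. *)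

theory Defs
  imports Main "HOL-Library.Nat_Bijection" "HOL-Library.Extended_Nat"
begin

text \<open>
  Programs for the partial recursive functions, interpreted on argument lists:
  zero, successor, projection, composition, primitive recursion (recursion variable
  first, step applied to counter, previous value, parameters) and minimization
  (minimized variable first). \<open>None\<close> means divergence.
\<close>

datatype recf = Z | S | Pj nat | Cn recf "recf list" | Pr recf recf | Mn recf

fun eval :: "recf \<Rightarrow> nat list \<Rightarrow> nat option" where
  "eval Z xs = Some 0"
| "eval S xs = (case xs of [] \<Rightarrow> None | x # _ \<Rightarrow> Some (Suc x))"
| "eval (Pj i) xs = (if i < length xs then Some (xs ! i) else None)"
| "eval (Cn p qs) xs =
     (if \<forall>q\<in>set qs. eval q xs \<noteq> None then eval p (map (\<lambda>q. the (eval q xs)) qs) else None)"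
| "eval (Pr p q) xs =
     (case xs of [] \<Rightarrow> None
      | n # ys \<Rightarrow> rec_nat (eval p ys) (\<lambda>k a. Option.bind a (\<lambda>v. eval q (k # v # ys))) n)"
| "eval (Mn p) xs =
     (if \<exists>y. eval p (y # xs) = Some 0 \<and> (\<forall>z<y. eval p (z # xs) \<noteq> None)
      then Some (LEAST y. eval p (y # xs) = Some 0) else None)"

definition computable :: "(nat \<Rightarrow> nat) \<Rightarrow> bool" where
  "computable g \<longleftrightarrow> (\<exists>p. \<forall>x. eval p [x] = Some (g x))"

definition ce :: "nat set \<Rightarrow> bool" where
  "ce A \<longleftrightarrow> (\<exists>p. A = {x. eval p [x] \<noteq> None})"

type_synonym axioms = "(nat \<times> nat set) set"

text \<open>The code of \<open>(x, D)\<close>; \<open>set_encode D\<close> is the canonical index of the finite set \<open>D\<close>.\<close>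

definition pair_code :: "nat \<times> nat set \<Rightarrow> nat" where
  "pair_code = (\<lambda>(x, D). prod_encode (x, set_encode D))"

text \<open>\<open>set_encode\<close> is only injective on finite sets, hence the explicit finiteness.\<close>

definition enumeration_operator :: "axioms \<Rightarrow> bool" where
  "enumeration_operator H \<longleftrightarrow> (\<forall>(x, D)\<in>H. finite D) \<and> ce (pair_code ` H)"

definition enum_apply :: "axioms \<Rightarrow> nat set \<Rightarrow> nat set" where
  "enum_apply H X = {x. \<exists>D. D \<subseteq> X \<and> (x, D) \<in> H}"

definition algebraic_closure_operator :: "axioms \<Rightarrow> bool" where
  "algebraic_closure_operator H \<longleftrightarrow>
     (\<forall>X. X \<subseteq> enum_apply H X \<and> enum_apply H (enum_apply H X) \<subseteq> enum_apply H X)"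

definition computable_approximation :: "(nat \<Rightarrow> axioms) \<Rightarrow> axioms \<Rightarrow> bool" where
  "computable_approximation \<alpha> H \<longleftrightarrow>
     (\<forall>s. finite (\<alpha> s) \<and> (\<forall>(x, D)\<in>\<alpha> s. finite D)) \<and>
     computable (\<lambda>s. set_encode (pair_code ` \<alpha> s)) \<and>
     (\<forall>s. \<alpha> s \<subseteq> \<alpha> (Suc s)) \<and> (\<Union>s. \<alpha> s) = H"

record dialectical =
  hop :: axioms                 \<comment> \<open>\<open>H\<close>\<close>
  prp :: "nat \<Rightarrow> nat"      \<comment> \<open>\<open>f\<close>\<close>
  rpl :: "nat \<Rightarrow> nat"      \<comment> \<open>\<open>f\<^sup>-\<close>\<close>
  ctr :: nat                    \<comment> \<open>\<open>c\<close>\<close>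

definition p_dialectical_system :: "dialectical \<Rightarrow> bool" where
  "p_dialectical_system p \<longleftrightarrow>
     enumeration_operator (hop p) \<and> algebraic_closure_operator (hop p) \<and>
     enum_apply (hop p) {} \<noteq> {} \<and> enum_apply (hop p) {ctr p} = UNIV \<and>
     computable (prp p) \<and> bij (prp p) \<and>
     computable (rpl p) \<and> (\<forall>x. infinite (range (\<lambda>n. (rpl p ^^ n) x)))"

definition tops :: "(nat \<Rightarrow> nat list) \<Rightarrow> nat \<Rightarrow> nat set" where
  "tops r x = {last (r y) | y. y < x \<and> r y \<noteq> []}"

definition step :: "dialectical \<Rightarrow> axioms \<Rightarrow> nat \<times> (nat \<Rightarrow> nat list) \<Rightarrow> nat \<times> (nat \<Rightarrow> nat list)" where
  "step p Hs = (\<lambda>(m, r).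
     let bad = (\<lambda>k. k \<le> m \<and> ctr p \<in> enum_apply Hs (tops r (Suc k)))
     in if \<exists>k. bad k
        then let z = (LEAST k. bad k)
             in (z, \<lambda>x. if x < z then r x
                        else if x = z then r z @ [rpl p (last (r z))]
                        else [])
        else (Suc m, \<lambda>x. if x \<le> m then r x
                         else if x = Suc m then [prp p (Suc m)]
                         else []))"

text \<open>The pair of \<open>m(s)\<close> and \<open>r\<^sub>s\<close>; stage \<open>s + 1\<close> consults \<open>H\<^sub>s\<close>.\<close>

primrec config :: "dialectical \<Rightarrow> (nat \<Rightarrow> axioms) \<Rightarrow> nat \<Rightarrow> nat \<times> (nat \<Rightarrow> nat list)" where
  "config p \<alpha> 0 = (0, \<lambda>x. if x = 0 then [prp p 0] else [])"
| "config p \<alpha> (Suc s) = step p (\<alpha> s) (config p \<alpha> s)"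

definition ptr :: "dialectical \<Rightarrow> (nat \<Rightarrow> axioms) \<Rightarrow> nat \<Rightarrow> nat" where
  "ptr p \<alpha> s = fst (config p \<alpha> s)"

definition stack :: "dialectical \<Rightarrow> (nat \<Rightarrow> axioms) \<Rightarrow> nat \<Rightarrow> nat \<Rightarrow> nat list" where
  "stack p \<alpha> s = snd (config p \<alpha> s)"

definition Ls :: "dialectical \<Rightarrow> (nat \<Rightarrow> axioms) \<Rightarrow> nat \<Rightarrow> nat \<Rightarrow> nat set" where
  "Ls p \<alpha> s x = tops (stack p \<alpha> s) x"

definition chi :: "dialectical \<Rightarrow> (nat \<Rightarrow> axioms) \<Rightarrow> nat \<Rightarrow> nat \<Rightarrow> nat set" where
  "chi p \<alpha> s i = enum_apply (\<alpha> s) (Ls p \<alpha> s (Suc i))"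

definition theses :: "dialectical \<Rightarrow> (nat \<Rightarrow> axioms) \<Rightarrow> nat \<Rightarrow> nat set" where
  "theses p \<alpha> s = (if s = 0 then {} else (\<Union>i<ptr p \<alpha> s. chi p \<alpha> s i))"

definition final_theses :: "dialectical \<Rightarrow> (nat \<Rightarrow> axioms) \<Rightarrow> nat set" where
  "final_theses p \<alpha> = {prp p x | x. \<exists>t. \<forall>s\<ge>t. prp p x \<in> theses p \<alpha> s}"

definition has_limit :: "(nat \<Rightarrow> 'a) \<Rightarrow> 'a \<Rightarrow> bool" where
  "has_limit g a \<longleftrightarrow> (\<exists>t. \<forall>s\<ge>t. g s = a)"

definition limit :: "(nat \<Rightarrow> 'a) \<Rightarrow> 'a" where
  "limit g = (THE a. has_limit g a)"

lemma limit_eqI: "has_limit g a \<Longrightarrow> limit g = a"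
  unfolding limit_def has_limit_def by (rule the_equality) (auto, metis nle_le)

definition stack_limit_exists :: "dialectical \<Rightarrow> (nat \<Rightarrow> axioms) \<Rightarrow> nat \<Rightarrow> bool" where
  "stack_limit_exists p \<alpha> v \<longleftrightarrow> (\<exists>\<sigma>. has_limit (\<lambda>s. stack p \<alpha> s v) \<sigma>)"

definition u_of :: "dialectical \<Rightarrow> (nat \<Rightarrow> axioms) \<Rightarrow> enat" where
  "u_of p \<alpha> = (GREATEST u. \<forall>v. enat v < u \<longrightarrow> stack_limit_exists p \<alpha> v)"

text \<open>The greatest element exists, so \<open>u_of\<close> is meaningful.\<close>

lemma u_of_greatest:
  shows "enat v < u_of p \<alpha> \<Longrightarrow> stack_limit_exists p \<alpha> v"
    and "(\<And>v. enat v < w \<Longrightarrow> stack_limit_exists p \<alpha> v) \<Longrightarrow> w \<le> u_of p \<alpha>"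
proof -
  let ?P = "\<lambda>u. \<forall>v. enat v < u \<longrightarrow> stack_limit_exists p \<alpha> v"
  have P: "?P (Sup {u. ?P u})"
    by (auto simp: less_Sup_iff)
  have up: "w \<le> Sup {u. ?P u}" if "?P w" for w
    using that by (intro Sup_upper) simp
  have eq: "u_of p \<alpha> = Sup {u. ?P u}"
    unfolding u_of_def by (rule Greatest_equality) (use P up in blast)+
  show "enat v < u_of p \<alpha> \<Longrightarrow> stack_limit_exists p \<alpha> v"
    using P eq by simp
  show "(\<And>v. enat v < w \<Longrightarrow> stack_limit_exists p \<alpha> v) \<Longrightarrow> w \<le> u_of p \<alpha>"
    using up eq by simp
qed

text \<open>\<open>L(v)\<close> for \<open>v\<close> in \<open>\<omega> \<union> {\<omega>}\<close>; for finite \<open>v\<close> meaningful only if \<open>v \<le> u\<close>.\<close>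

fun L :: "dialectical \<Rightarrow> (nat \<Rightarrow> axioms) \<Rightarrow> enat \<Rightarrow> nat set" where
  "L p \<alpha> (enat v) = limit (\<lambda>s. Ls p \<alpha> s v)"
| "L p \<alpha> \<infinity> = (\<Union>v. limit (\<lambda>s. Ls p \<alpha> s v))"

text \<open>\<open>L(v)\<close> is a genuine limit whenever \<open>v \<le> u\<close>.\<close>

lemma Ls_has_limit:
  assumes "enat v \<le> u_of p \<alpha>"
  shows "has_limit (\<lambda>s. Ls p \<alpha> s v) (L p \<alpha> (enat v))"
proof -
  have "\<exists>t \<sigma>. \<forall>s\<ge>t. \<forall>y<v. stack p \<alpha> s y = \<sigma> y"
    using assms
  proof (induction v)
    case (Suc v)
    then obtain t \<sigma> where t: "\<And>s y. s \<ge> t \<Longrightarrow> y < v \<Longrightarrow> stack p \<alpha> s y = \<sigma> y"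
      by (meson Suc_ile_eq less_imp_le)
    have "stack_limit_exists p \<alpha> v"
      using Suc.prems by (intro u_of_greatest(1)) (simp add: Suc_ile_eq)
    then obtain t' a where a: "\<And>s. s \<ge> t' \<Longrightarrow> stack p \<alpha> s v = a"
      unfolding stack_limit_exists_def has_limit_def by blast
    have "\<forall>s\<ge>max t t'. \<forall>y<Suc v. stack p \<alpha> s y = (\<sigma>(v := a)) y"
      by (simp add: t a less_Suc_eq)
    then show ?case by blast
  qed simp
  then obtain t \<sigma> where t: "\<And>s y. s \<ge> t \<Longrightarrow> y < v \<Longrightarrow> stack p \<alpha> s y = \<sigma> y"
    by blast
  have "Ls p \<alpha> s v = tops \<sigma> v" if "s \<ge> t" for s
    unfolding Ls_def tops_def using t[OF that] by force
  then have "has_limit (\<lambda>s. Ls p \<alpha> s v) (tops \<sigma> v)"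
    unfolding has_limit_def by blast
  then show ?thesis
    using limit_eqI by fastforce
qed

end

theory Submission
  imports Defs
begin

text \<open>
  The stack at position \<open>m(s + 1)\<close> always changes at stage \<open>s + 1\<close>, and no stack below it does.
  Hence \<open>v \<le> u\<close> iff \<open>v \<le> m(s)\<close> for almost all \<open>s\<close>, i.e. \<open>u\<close> is the lower limit of \<open>m\<close>.
  Looking at stages where \<open>m\<close> attains its minimum over the remaining stages gives
  \<open>A\<^sub>p = \<Union>{H(L(v)) | 0 < v \<le> u}\<close>. Independence of the approximation holds because the limits
  have a description in terms of \<open>H\<close> alone: given \<open>L(v)\<close>, the stack at \<open>v\<close> converges iff some
  iterate of \<open>f\<^sup>-\<close> at \<open>f\<^sub>v\<close> is consistent with \<open>L(v)\<close> (i.e. together they do not derive \<open>c\<close>), and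
  its final top is then the first such iterate. If \<open>u = \<omega>\<close> and \<open>f\<^sub>v\<close> is not the final top at
  \<open>v\<close>, then \<open>f\<^sub>v\<close> is inconsistent with \<open>L(v)\<close>, so \<open>f\<^sub>v \<notin> H(L(\<omega>))\<close>.
\<close>

section \<open>Enumeration operators and tops of stacks\<close>

lemma enum_apply_mono: "A \<subseteq> B \<Longrightarrow> X \<subseteq> Y \<Longrightarrow> enum_apply A X \<subseteq> enum_apply B Y"
  unfolding enum_apply_def by blast

text \<open>A derivation uses one axiom, whose premise set is finite and therefore lies in a single
  member of the chain.\<close>

lemma enum_apply_UN_chain:
  fixes X :: "nat \<Rightarrow> nat set"
  assumes "x \<in> enum_apply A (\<Union>n. X n)" "mono X" "\<And>x D. (x, D) \<in> A \<Longrightarrow> finite D"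
  shows "\<exists>n. x \<in> enum_apply A (X n)"
proof -
  obtain D where D: "D \<subseteq> (\<Union>n. X n)" "(x, D) \<in> A"
    using assms(1) unfolding enum_apply_def by blast
  have "\<exists>n. D \<subseteq> X n"
    using assms(3)[OF D(2)] D(1)
  proof (induction D)
    case (insert d D)
    then obtain i j where "d \<in> X i" "D \<subseteq> X j" by auto
    moreover have "X i \<subseteq> X (max i j)" "X j \<subseteq> X (max i j)"
      using \<open>mono X\<close> by (simp_all add: monoD)
    ultimately show ?case by blast
  qed simp
  then show ?thesis
    using D(2) unfolding enum_apply_def by blast
qed

lemma tops_cong: "(\<And>y. y < x \<Longrightarrow> r y = r' y) \<Longrightarrow> tops r x = tops r' x"
  unfolding tops_def by metis

lemma tops_mono: "x \<le> y \<Longrightarrow> tops r x \<subseteq> tops r y"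
  unfolding tops_def by fastforce

lemma tops_Suc: "r x \<noteq> [] \<Longrightarrow> tops r (Suc x) = insert (last (r x)) (tops r x)"
  unfolding tops_def by (auto simp: less_Suc_eq)

section \<open>The procedure along one approximation\<close>

locale dialectical_run =
  fixes p :: dialectical and \<alpha> :: "nat \<Rightarrow> axioms"
  assumes closure: "algebraic_closure_operator (hop p)"
    and finite_premises: "\<And>x D. (x, D) \<in> hop p \<Longrightarrow> finite D"
    and stage_Suc: "\<And>s. \<alpha> s \<subseteq> \<alpha> (Suc s)"
    and stages: "(\<Union>s. \<alpha> s) = hop p"
begin

abbreviation "H \<equiv> enum_apply (hop p)"
abbreviation "m \<equiv> ptr p \<alpha>"
abbreviation "r \<equiv> stack p \<alpha>"
abbreviation "u \<equiv> u_of p \<alpha>"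

definition bad :: "nat \<Rightarrow> nat \<Rightarrow> bool" where
  "bad s k \<longleftrightarrow> k \<le> m s \<and> ctr p \<in> chi p \<alpha> s k"

lemma H_mono: "X \<subseteq> Y \<Longrightarrow> H X \<subseteq> H Y"
  by (rule enum_apply_mono) simp

lemma H_stage: "enum_apply (\<alpha> s) X \<subseteq> H X"
  using stages by (intro enum_apply_mono) auto

lemma H_eventually:
  assumes "x \<in> H X"
  shows "\<forall>\<^sub>F s in sequentially. x \<in> enum_apply (\<alpha> s) X"
proof -
  obtain D t where D: "D \<subseteq> X" "(x, D) \<in> \<alpha> t"
    using assms stages unfolding enum_apply_def by blast
  then have "x \<in> enum_apply (\<alpha> s) X" if "t \<le> s" for s
    using lift_Suc_mono_le[of \<alpha>, OF stage_Suc that] unfolding enum_apply_def by blast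
  then show ?thesis
    unfolding eventually_sequentially by blast
qed

lemma extensive: "X \<subseteq> H X" and idempotent: "H (H X) \<subseteq> H X"
  using closure unfolding algebraic_closure_operator_def by blast+

lemma config_Suc:
  "config p \<alpha> (Suc s) =
    (if \<exists>k. bad s k
     then let z = LEAST k. bad s k
          in (z, \<lambda>x. if x < z then r s x else if x = z then r s z @ [rpl p (last (r s z))] else [])
     else (Suc (m s), \<lambda>x. if x \<le> m s then r s x
                        else if x = Suc (m s) then [prp p (Suc (m s))] else []))"
  by (simp only: config.simps step_def split_beta Let_def bad_def chi_def Ls_def ptr_def stack_def)

text \<open>In the second case the least bad index is named \<open>m (Suc s)\<close>, so later case
  distinctions meet no \<open>LEAST\<close>.\<close>

lemma config_cases:
  obtains
    (good) "\<And>k. \<not> bad s k" "m (Suc s) = Suc (m s)"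
      "r (Suc s) = (\<lambda>x. if x \<le> m s then r s x
                        else if x = Suc (m s) then [prp p (Suc (m s))] else [])"
  | (bad) "bad s (m (Suc s))" "\<And>k. bad s k \<Longrightarrow> m (Suc s) \<le> k"
      "r (Suc s) = (\<lambda>x. if x < m (Suc s) then r s x
                        else if x = m (Suc s) then r s x @ [rpl p (last (r s x))] else [])"
proof (cases "\<exists>k. bad s k")
  case True
  define z where "z = (LEAST k. bad s k)"
  have "config p \<alpha> (Suc s) =
    (z, \<lambda>x. if x < z then r s x else if x = z then r s z @ [rpl p (last (r s z))] else [])"
    unfolding config_Suc z_def Let_def using True by (rule if_P)
  then have "m (Suc s) = z" and
    "r (Suc s) = (\<lambda>x. if x < z then r s x else if x = z then r s z @ [rpl p (last (r s z))] else [])"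
    unfolding ptr_def stack_def[of p \<alpha> "Suc s"] by simp_all
  moreover have "bad s z" "\<And>k. bad s k \<Longrightarrow> z \<le> k"
    using True unfolding z_def by (auto intro: LeastI Least_le)
  ultimately show ?thesis by (intro bad) (auto simp: fun_eq_iff)
next
  case False
  then have "config p \<alpha> (Suc s) = (Suc (m s), \<lambda>x. if x \<le> m s then r s x
      else if x = Suc (m s) then [prp p (Suc (m s))] else [])"
    unfolding config_Suc by (rule if_not_P)
  then have "m (Suc s) = Suc (m s)"
    "r (Suc s) = (\<lambda>x. if x \<le> m s then r s x
      else if x = Suc (m s) then [prp p (Suc (m s))] else [])"
    unfolding ptr_def[of p \<alpha> "Suc s"] stack_def[of p \<alpha> "Suc s"] by simp_all
  with False show ?thesis by (intro good) auto
qed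

section \<open>Shape of the stacks\<close>

lemma stack_empty_iff: "r s x = [] \<longleftrightarrow> m s < x"
proof (induction s arbitrary: x)
  case (Suc s)
  show ?case
    by (cases rule: config_cases[of s]) (auto simp: Suc.IH bad_def)
qed (simp add: ptr_def stack_def)

lemma stack_below: "x < m (Suc s) \<Longrightarrow> r (Suc s) x = r s x"
  by (cases rule: config_cases[of s]) auto

lemma stack_at_ptr: "r (Suc s) (m (Suc s)) \<noteq> r s (m (Suc s))"
proof (cases rule: config_cases[of s])
  case good
  then have "r s (m (Suc s)) = []" by (simp add: stack_empty_iff)
  then show ?thesis using good by simp
qed auto

text \<open>The bound includes x = m(s+1), where the stack does change, because L_s(x) looks only at
  stacks strictly below x.\<close>

lemma Ls_below: "x \<le> m (Suc s) \<Longrightarrow> Ls p \<alpha> (Suc s) x = Ls p \<alpha> s x"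
  unfolding Ls_def by (rule tops_cong) (simp add: stack_below)

lemma Ls_Suc: "x \<le> m s \<Longrightarrow> Ls p \<alpha> s (Suc x) = insert (last (r s x)) (Ls p \<alpha> s x)"
  unfolding Ls_def by (rule tops_Suc) (simp add: stack_empty_iff)

lemma Ls_mono: "x \<le> y \<Longrightarrow> Ls p \<alpha> s x \<subseteq> Ls p \<alpha> s y"
  unfolding Ls_def by (rule tops_mono)

text \<open>Each entry but the last was discarded when it derived c together with L_s(v). This
  survives later stages: a change below v empties stack v, so as long as the stack lasts, L_s(v) is
  the set used then. Taking H instead of H_s frees the derivation from its stage.\<close>

lemma stack_chain:
  assumes "v \<le> m s"
  shows "\<exists>n. r s v = map (\<lambda>i. (rpl p ^^ i) (prp p v)) [0..<Suc n] \<and>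
    (\<forall>i<n. ctr p \<in> H (insert ((rpl p ^^ i) (prp p v)) (Ls p \<alpha> s v)))"
  using assms
proof (induction s)
  case 0
  then show ?case by (auto simp: ptr_def stack_def intro!: exI[of _ 0])
next
  case (Suc s)
  show ?case
  proof (cases rule: config_cases[of s])
    case good
    show ?thesis
    proof (cases "v \<le> m s")
      case True
      then show ?thesis
        using Suc.IH[OF True] good Ls_below[of v s] by simp
    next
      case False
      then have "v = Suc (m s)" using Suc.prems good by simp
      then show ?thesis
        using good by (intro exI[of _ 0]) simp
    qed
  next
    case bad
    then have "v \<le> m s" using Suc.prems unfolding bad_def by simp
    then obtain n where n: "r s v = map (\<lambda>i. (rpl p ^^ i) (prp p v)) [0..<Suc n]"
      "\<forall>i<n. ctr p \<in> H (insert ((rpl p ^^ i) (prp p v)) (Ls p \<alpha> s v))"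
      using Suc.IH by blast
    have Ls: "Ls p \<alpha> (Suc s) v = Ls p \<alpha> s v"
      using Ls_below Suc.prems by blast
    show ?thesis
    proof (cases "v < m (Suc s)")
      case True
      then show ?thesis using n Ls bad by auto
    next
      case False
      with Suc.prems have v: "v = m (Suc s)" by simp
      \<comment> \<open>The current top, the n-th iterate, is what makes v bad, so it joins the
        discarded entries.\<close>
      have "ctr p \<in> H (Ls p \<alpha> s (Suc v))"
        using bad(1) H_stage v unfolding bad_def chi_def by blast
      then have "ctr p \<in> H (insert ((rpl p ^^ n) (prp p v)) (Ls p \<alpha> s v))"
        using Ls_Suc[OF \<open>v \<le> m s\<close>] n(1) by simp
      moreover have "r (Suc s) v = map (\<lambda>i. (rpl p ^^ i) (prp p v)) [0..<Suc (Suc n)]"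
        using bad(3) n(1) v by simp
      ultimately show ?thesis
        using n(2) Ls by (intro exI[of _ "Suc n"]) (auto simp: less_Suc_eq simp del: upt_Suc)
    qed
  qed
qed

section \<open>Limits of the stacks and the value of u\<close>

lemma stack_stable:
  assumes "\<And>s. t \<le> s \<Longrightarrow> v \<le> m s" "y < v" "t \<le> s"
  shows "r s y = r t y"
  using \<open>t \<le> s\<close>
proof (induction s rule: dec_induct)
  case (step s)
  then show ?case
    using assms(1)[of "Suc s"] \<open>y < v\<close> stack_below[of y s] by simp
qed simp

lemma le_u_iff: "enat v \<le> u \<longleftrightarrow> (\<forall>\<^sub>F s in sequentially. v \<le> m s)"
proof
  show "\<forall>\<^sub>F s in sequentially. v \<le> m s" if "enat v \<le> u"
    using that
  proof (induction v)
    case (Suc v)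
    then have "enat v < u" by (simp add: Suc_ile_eq)
    then obtain \<sigma> t1 where t1: "\<And>s. t1 \<le> s \<Longrightarrow> r s v = \<sigma>"
      using u_of_greatest(1) unfolding stack_limit_exists_def has_limit_def by metis
    obtain t2 where t2: "\<And>s. t2 \<le> s \<Longrightarrow> v \<le> m s"
      using Suc.IH \<open>enat v < u\<close> unfolding eventually_sequentially by (meson less_imp_le)
    \<comment> \<open>Both s and its predecessor must lie past t1: m(s) = v would make stack v
      change between them.\<close>
    have "Suc v \<le> m s" if s: "Suc (t1 + t2) \<le> s" for s
    proof -
      obtain s' where s': "s = Suc s'" using s Suc_le_D by blast
      then have "m s \<noteq> v"
        using s t1[of s] t1[of s'] stack_at_ptr[of s'] by auto
      then show ?thesis using t2[of s] s by simp
    qed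
    then show ?case unfolding eventually_sequentially by blast
  qed simp
  show "enat v \<le> u" if ev: "\<forall>\<^sub>F s in sequentially. v \<le> m s"
  proof -
    obtain t where "\<And>s. t \<le> s \<Longrightarrow> v \<le> m s"
      using ev unfolding eventually_sequentially by blast
    then have "stack_limit_exists p \<alpha> y" if "y < v" for y
      using stack_stable[OF _ that] unfolding stack_limit_exists_def has_limit_def by blast
    then show ?thesis by (intro u_of_greatest(2)) simp
  qed
qed

text \<open>The limit is attained at t itself, so a single well-chosen stage suffices to read off
  L(v).\<close>

lemma Ls_stable:
  assumes "\<And>s. t \<le> s \<Longrightarrow> v \<le> m s"
  shows "Ls p \<alpha> t v = L p \<alpha> (enat v)"
proof -
  have "Ls p \<alpha> s v = Ls p \<alpha> t v" if "t \<le> s" for s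
    unfolding Ls_def using stack_stable[OF assms _ that] by (intro tops_cong)
  then have "has_limit (\<lambda>s. Ls p \<alpha> s v) (Ls p \<alpha> t v)"
    unfolding has_limit_def by blast
  then show ?thesis by (simp add: limit_eqI)
qed

lemma obtain_stable:
  assumes "enat v \<le> u"
  obtains t where "\<And>s. t \<le> s \<Longrightarrow> v \<le> m s" "\<And>s. t \<le> s \<Longrightarrow> Ls p \<alpha> s v = L p \<alpha> (enat v)"
proof -
  obtain t where t: "\<And>s. t \<le> s \<Longrightarrow> v \<le> m s"
    using assms unfolding le_u_iff eventually_sequentially by blast
  then have "Ls p \<alpha> s v = L p \<alpha> (enat v)" if "t \<le> s" for s
    using that by (intro Ls_stable) simp
  with t show ?thesis using that by blast
qed

lemma L_mono:
  assumes "v \<le> w" "enat w \<le> u"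
  shows "L p \<alpha> (enat v) \<subseteq> L p \<alpha> (enat w)"
proof -
  obtain t where t: "\<And>s. t \<le> s \<Longrightarrow> w \<le> m s" "Ls p \<alpha> t w = L p \<alpha> (enat w)"
    using obtain_stable[OF assms(2)] by (metis order_refl)
  have "Ls p \<alpha> t v = L p \<alpha> (enat v)"
    using t(1) \<open>v \<le> w\<close> by (intro Ls_stable) (meson order_trans)
  then show ?thesis
    using Ls_mono[OF \<open>v \<le> w\<close>, of t] t(2) by simp
qed

text \<open>A derivation of c from L(v+1) would appear in H_s at some stage s with L_s(v+1) already
  final. Then v is bad and the next pointer falls to v or lower.\<close>

lemma consistent:
  assumes "enat (Suc v) \<le> u"
  shows "ctr p \<notin> H (L p \<alpha> (enat (Suc v)))"
proof
  assume "ctr p \<in> H (L p \<alpha> (enat (Suc v)))"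
  then obtain t1 where t1: "\<And>s. t1 \<le> s \<Longrightarrow> ctr p \<in> enum_apply (\<alpha> s) (L p \<alpha> (enat (Suc v)))"
    using H_eventually unfolding eventually_sequentially by blast
  obtain t2 where t2: "\<And>s. t2 \<le> s \<Longrightarrow> Suc v \<le> m s"
    "\<And>s. t2 \<le> s \<Longrightarrow> Ls p \<alpha> s (Suc v) = L p \<alpha> (enat (Suc v))"
    using obtain_stable[OF assms] by blast
  define s where "s = t1 + t2"
  have "bad s v"
    using t1[of s] t2[of s] unfolding bad_def chi_def s_def by simp
  then have "m (Suc s) \<le> v"
    by (cases rule: config_cases[of s]) auto
  then show False
    using t2(1)[of "Suc s"] unfolding s_def by simp
qed

section \<open>The final theses as a union of closures\<close>

lemma final_theses_eq: "final_theses p \<alpha> = (\<Union>v \<in> {v. 0 < v \<and> enat v \<le> u}. H (L p \<alpha> (enat v)))"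
  if "surj (prp p)"
proof (intro subset_antisym subsetI)
  fix x assume "x \<in> final_theses p \<alpha>"
  then obtain t where t: "\<And>s. t \<le> s \<Longrightarrow> x \<in> theses p \<alpha> s"
    unfolding final_theses_def by blast
  \<comment> \<open>Where m is least among the stages from t on, no later pointer is below m(s). So
    m(s) <= u, and L_s(m(s)) is already final.\<close>
  obtain s where s: "t \<le> s" "\<And>s'. t \<le> s' \<Longrightarrow> m s \<le> m s'"
    using ex_has_least_nat[of "\<lambda>s. t \<le> s" t m] by blast
  obtain i where i: "i < m s" "x \<in> chi p \<alpha> s i"
    using t[OF s(1)] unfolding theses_def by (auto split: if_splits)
  have "x \<in> H (Ls p \<alpha> s (Suc i))"
    using i(2) H_stage unfolding chi_def by blast
  then have "x \<in> H (Ls p \<alpha> s (m s))"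
    using H_mono[OF Ls_mono[of "Suc i" "m s" s]] i(1) by auto
  moreover have "Ls p \<alpha> s (m s) = L p \<alpha> (enat (m s))"
    using s by (intro Ls_stable) simp
  moreover have "enat (m s) \<le> u"
    using s(2) unfolding le_u_iff eventually_sequentially by blast
  ultimately show "x \<in> (\<Union>v \<in> {v. 0 < v \<and> enat v \<le> u}. H (L p \<alpha> (enat v)))"
    using i(1) by (intro UN_I[of "m s"]) auto
next
  fix x assume "x \<in> (\<Union>v \<in> {v. 0 < v \<and> enat v \<le> u}. H (L p \<alpha> (enat v)))"
  then obtain v where v: "0 < v" "enat v \<le> u" "x \<in> H (L p \<alpha> (enat v))"
    by blast
  \<comment> \<open>L(v) enters the theses through chi(v-1). Hence L(0) contributes nothing, even
    though H of the empty set need not be empty.\<close>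
  then obtain i where i: "v = Suc i" using gr0_implies_Suc by blast
  obtain t1 where t1: "\<And>s. t1 \<le> s \<Longrightarrow> x \<in> enum_apply (\<alpha> s) (L p \<alpha> (enat v))"
    using H_eventually[OF v(3)] unfolding eventually_sequentially by blast
  obtain t2 where t2: "\<And>s. t2 \<le> s \<Longrightarrow> v \<le> m s"
    "\<And>s. t2 \<le> s \<Longrightarrow> Ls p \<alpha> s v = L p \<alpha> (enat v)"
    using obtain_stable[OF v(2)] by blast
  \<comment> \<open>The successor excludes stage 0, where \<open>theses\<close> is empty by
    definition.\<close>
  have "x \<in> theses p \<alpha> s" if s: "Suc (t1 + t2) \<le> s" for s
  proof -
    have "x \<in> chi p \<alpha> s i"
      using s t1[of s] t2(2)[of s] unfolding chi_def i by simp
    moreover have "i < m s"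
      using t2(1)[of s] s unfolding i by simp
    ultimately show ?thesis
      using s unfolding theses_def by auto
  qed
  moreover obtain y where "x = prp p y"
    using \<open>surj (prp p)\<close> by blast
  ultimately show "x \<in> final_theses p \<alpha>"
    unfolding final_theses_def by blast
qed

lemma L_infinity:
  assumes "u = \<infinity>"
  shows "H (L p \<alpha> \<infinity>) = (\<Union>v \<in> {v. 0 < v \<and> enat v \<le> u}. H (L p \<alpha> (enat v)))"
proof (intro subset_antisym subsetI)
  have eq: "L p \<alpha> \<infinity> = (\<Union>v. L p \<alpha> (enat v))" by simp
  show "x \<in> H (L p \<alpha> \<infinity>)"
    if "x \<in> (\<Union>v \<in> {v. 0 < v \<and> enat v \<le> u}. H (L p \<alpha> (enat v)))" for x
    using that H_mono[of "L p \<alpha> (enat _)" "L p \<alpha> \<infinity>"] unfolding eq by blast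
  fix x assume x: "x \<in> H (L p \<alpha> \<infinity>)"
  have "mono (\<lambda>v. L p \<alpha> (enat v))"
    by (rule monoI, rule L_mono) (simp_all add: assms)
  then obtain v where "x \<in> H (L p \<alpha> (enat v))"
    using enum_apply_UN_chain[OF x[unfolded eq]] finite_premises by blast
  \<comment> \<open>Compactness may have produced v = 0, an index missing from the union;
    monotonicity allows moving up by one.\<close>
  then have "x \<in> H (L p \<alpha> (enat (Suc v)))"
    using H_mono[OF L_mono[of v "Suc v"]] assms by auto
  then show "x \<in> (\<Union>v \<in> {v. 0 < v \<and> enat v \<le> u}. H (L p \<alpha> (enat v)))"
    using assms by (intro UN_I[of "Suc v"]) auto
qed

lemma H_L_infinity:
  assumes "u = \<infinity>" "surj (prp p)"
  shows "H (L p \<alpha> \<infinity>) = L p \<alpha> \<infinity>"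
proof (intro subset_antisym subsetI)
  fix x assume x: "x \<in> H (L p \<alpha> \<infinity>)"
  have L_sub: "L p \<alpha> (enat v) \<subseteq> L p \<alpha> \<infinity>" for v by auto
  obtain v where v: "x = prp p v"
    using \<open>surj (prp p)\<close> by blast
  obtain t where t: "\<And>s. t \<le> s \<Longrightarrow> Suc v \<le> m s" "Ls p \<alpha> t (Suc v) = L p \<alpha> (enat (Suc v))"
    using obtain_stable[of "Suc v"] assms(1) by (metis enat_ord_code(3) order_refl)
  have Ls_sub: "Ls p \<alpha> t v \<subseteq> L p \<alpha> \<infinity>"
    using Ls_mono[of v "Suc v" t] t(2) L_sub by auto
  obtain n where n: "r t v = map (\<lambda>i. (rpl p ^^ i) (prp p v)) [0..<Suc n]"
    "\<forall>i<n. ctr p \<in> H (insert ((rpl p ^^ i) (prp p v)) (Ls p \<alpha> t v))"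
    using stack_chain[of v t] t(1)[of t] by auto
  \<comment> \<open>This says that the settled stack at v is just f_v. Otherwise f_v and L(v) derive
    c; both lie in H(L(omega)), so by idempotence c does too, hence c is in some H(L(w)), against
    \<open>consistent\<close>.\<close>
  have "n = 0"
  proof (rule ccontr)
    assume "n \<noteq> 0"
    then have "ctr p \<in> H (insert x (Ls p \<alpha> t v))"
      using n(2) v by (metis funpow_0 neq0_conv)
    moreover have "insert x (Ls p \<alpha> t v) \<subseteq> H (L p \<alpha> \<infinity>)"
      using x Ls_sub extensive by blast
    ultimately have "ctr p \<in> H (L p \<alpha> \<infinity>)"
      using H_mono idempotent by blast
    then obtain w where "0 < w" "ctr p \<in> H (L p \<alpha> (enat w))"
      unfolding L_infinity[OF assms(1)] by blast
    then show False
      using consistent[of "w - 1"] assms(1) by simp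
  qed
  then have "x \<in> Ls p \<alpha> t (Suc v)"
    using n(1) v t(1)[of t] Ls_Suc[of v t] by simp
  then show "x \<in> L p \<alpha> \<infinity>"
    using t(2) L_sub by blast
qed (use extensive in blast)

lemma final_theses_L:
  assumes "u > 0" "surj (prp p)"
  shows "final_theses p \<alpha> = H (L p \<alpha> u)"
proof (cases u)
  case (enat w)
  \<comment> \<open>For finite u the last member of the union in \<open>final_theses_eq\<close>
    contains all the others.\<close>
  then have "H (L p \<alpha> (enat v)) \<subseteq> H (L p \<alpha> u)" if "enat v \<le> u" for v
    using that L_mono[of v w] H_mono by (simp del: L.simps)
  moreover have "0 < w" using enat assms(1) by (simp add: zero_enat_def)
  ultimately show ?thesis
    unfolding final_theses_eq[OF assms(2)] enat
    by (intro subset_antisym UN_least UN_upper) auto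
next
  case infinity
  then show ?thesis
    using final_theses_eq[OF assms(2)] L_infinity by simp
qed

lemma final_theses_empty:
  assumes "u = 0" "surj (prp p)"
  shows "final_theses p \<alpha> = {}"
  unfolding final_theses_eq[OF assms(2)] using assms(1) by (auto simp: zero_enat_def)

section \<open>The limits described through H alone\<close>

definition consistent_iterate :: "nat \<Rightarrow> nat \<Rightarrow> bool" where
  "consistent_iterate v n \<longleftrightarrow> ctr p \<notin> H (insert ((rpl p ^^ n) (prp p v)) (L p \<alpha> (enat v)))"

text \<open>Entries below the settled top derive c with L(v) by \<open>stack_chain\<close>; the top
  does not, by \<open>consistent\<close>. So the top is the first consistent iterate.\<close>

lemma limit_top:
  assumes "enat (Suc v) \<le> u"
  shows "\<exists>n. consistent_iterate v n"
    and "L p \<alpha> (enat (Suc v)) =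
      insert ((rpl p ^^ (LEAST n. consistent_iterate v n)) (prp p v)) (L p \<alpha> (enat v))"
proof -
  obtain t where t: "\<And>s. t \<le> s \<Longrightarrow> Suc v \<le> m s" "Ls p \<alpha> t (Suc v) = L p \<alpha> (enat (Suc v))"
    using obtain_stable[OF assms] by (metis order_refl)
  have Ls: "Ls p \<alpha> t v = L p \<alpha> (enat v)"
    using t(1) by (intro Ls_stable) (meson Suc_leD)
  have "v \<le> m t" using t(1)[of t] by simp
  then obtain n where n: "r t v = map (\<lambda>i. (rpl p ^^ i) (prp p v)) [0..<Suc n]"
    "\<forall>i<n. \<not> consistent_iterate v i"
    using stack_chain[of v t] unfolding consistent_iterate_def Ls by blast
  have L: "L p \<alpha> (enat (Suc v)) = insert ((rpl p ^^ n) (prp p v)) (L p \<alpha> (enat v))"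
    using Ls_Suc[OF \<open>v \<le> m t\<close>] t(2) Ls n(1) by simp
  then have "consistent_iterate v n"
    using consistent[OF assms] unfolding consistent_iterate_def by simp
  moreover from this n(2) have "(LEAST n. consistent_iterate v n) = n"
    by (intro Least_equality) (auto simp: not_less[symmetric])
  ultimately show "\<exists>n. consistent_iterate v n" "L p \<alpha> (enat (Suc v)) =
      insert ((rpl p ^^ (LEAST n. consistent_iterate v n)) (prp p v)) (L p \<alpha> (enat v))"
    using L by auto
qed

text \<open>Once everything below v is settled, stack v can only grow, and it cannot pass a
  consistent iterate. After reaching its maximal length it is never extended, so m(s) = v stops
  occurring.\<close>

lemma converges_if_consistent_iterate:
  assumes "enat v \<le> u" "consistent_iterate v n"
  shows "enat (Suc v) \<le> u"
proof -
  obtain t where t: "\<And>s. t \<le> s \<Longrightarrow> v \<le> m s" "\<And>s. t \<le> s \<Longrightarrow> Ls p \<alpha> s v = L p \<alpha> (enat v)"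
    using obtain_stable[OF assms(1)] by blast
  have "length (r s v) < n + 2" if "t \<le> s" for s
  proof -
    obtain k where "r s v = map (\<lambda>i. (rpl p ^^ i) (prp p v)) [0..<Suc k]"
      "\<forall>i<k. \<not> consistent_iterate v i"
      using stack_chain[OF t(1)] t(2) \<open>t \<le> s\<close> unfolding consistent_iterate_def by metis
    moreover from this assms(2) have "k \<le> n" using not_less by blast
    ultimately show ?thesis by simp
  qed
  then obtain s0 where s0: "t \<le> s0" "\<And>s. t \<le> s \<Longrightarrow> length (r s v) \<le> length (r s0 v)"
    using ex_has_greatest_nat[of "\<lambda>s. t \<le> s" t "\<lambda>s. length (r s v)" "n + 2"] by auto
  \<comment> \<open>Since the pointer stays at v or above, stack v is never emptied or restarted; it
    changes only by an appended entry.\<close>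
  have grow: "length (r (Suc s) v) = length (r s v) + (if m (Suc s) = v then 1 else 0)"
    if "t \<le> s" for s
    using t(1)[OF that] t(1)[of "Suc s"] that by (cases rule: config_cases[of s]) auto
  have max: "length (r s v) = length (r s0 v)" if "s0 \<le> s" for s
    using that
  proof (induction s rule: dec_induct)
    case (step s)
    then show ?case using grow[of s] s0(2)[of "Suc s"] s0(1) by auto
  qed simp
  have "Suc v \<le> m s" if s: "Suc s0 \<le> s" for s
  proof -
    obtain s' where s': "s = Suc s'" using s Suc_le_D by blast
    then have "m s \<noteq> v"
      using s max[of s'] max[of s] grow[of s'] s0(1) by auto
    then show ?thesis using t(1)[of s] s s0(1) by simp
  qed
  then show ?thesis
    unfolding le_u_iff eventually_sequentially by blast
qed

end

section \<open>Comparison of two approximations\<close>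

lemma limits_agree:
  assumes "dialectical_run p \<alpha>" "dialectical_run p \<beta>" "enat v \<le> u_of p \<alpha>"
  shows "enat v \<le> u_of p \<beta> \<and> L p \<beta> (enat v) = L p \<alpha> (enat v)"
  using assms(3)
proof (induction v)
  case 0
  then show ?case by (simp add: Ls_def tops_def flip: zero_enat_def) (simp add: zero_enat_def Ls_def tops_def)
next
  case (Suc v)
  interpret a: dialectical_run p \<alpha> by fact
  interpret b: dialectical_run p \<beta> by fact
  have IH: "enat v \<le> b.u" "L p \<beta> (enat v) = L p \<alpha> (enat v)"
    using Suc by (simp_all add: Suc_ile_eq)
  \<comment> \<open>Consistency of an iterate depends on the approximation only through L(v). This
    is why the induction carries the equality of the L(v) along with the bound on u.\<close>
  have same: "b.consistent_iterate v = a.consistent_iterate v"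
    unfolding a.consistent_iterate_def b.consistent_iterate_def IH(2) ..
  have "enat (Suc v) \<le> b.u"
    using b.converges_if_consistent_iterate[OF IH(1)] a.limit_top(1)[OF Suc.prems] same by auto
  then show ?case
    using a.limit_top(2)[OF Suc.prems] b.limit_top(2) same IH(2) by simp
qed

text \<open>Lifts \<open>limits_agree\<close>, which speaks of finite v only, to values of u that
  may be infinite.\<close>

lemma enat_le_by_finite:
  fixes a b :: enat
  assumes "\<And>v. enat v \<le> a \<Longrightarrow> enat v \<le> b"
  shows "a \<le> b"
proof (cases a)
  case infinity
  have "b \<noteq> enat k" for k
    using assms[of "Suc k"] infinity by auto
  then show ?thesis using infinity by (cases b) auto
qed (use assms in auto)

theorem theorem1p3:
  fixes p :: dialectical and \<alpha> :: "nat \<Rightarrow> axioms"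
  assumes "p_dialectical_system p"
    and "computable_approximation \<alpha> (hop p)"
  shows "(\<forall>\<beta>. computable_approximation \<beta> (hop p) \<longrightarrow>
            u_of p \<beta> = u_of p \<alpha> \<and> final_theses p \<beta> = final_theses p \<alpha>) \<and>
         (u_of p \<alpha> > 0 \<longrightarrow>
            final_theses p \<alpha> = enum_apply (hop p) (L p \<alpha> (u_of p \<alpha>)) \<and>
            (u_of p \<alpha> = \<infinity> \<longrightarrow> final_theses p \<alpha> = L p \<alpha> \<infinity>)) \<and>
         (u_of p \<alpha> = 0 \<longrightarrow> final_theses p \<alpha> = {})"
proof -
  have surj: "surj (prp p)"
    using assms(1) unfolding p_dialectical_system_def by (simp add: bij_is_surj)
  have run: "dialectical_run p \<gamma>" if "computable_approximation \<gamma> (hop p)" for \<gamma>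
    using assms(1) that
    unfolding dialectical_run_def p_dialectical_system_def enumeration_operator_def
      computable_approximation_def by blast
  interpret dialectical_run p \<alpha> by (rule run) fact
  have "u_of p \<beta> = u \<and> final_theses p \<beta> = final_theses p \<alpha>"
    if \<beta>: "computable_approximation \<beta> (hop p)" for \<beta>
  proof -
    interpret b: dialectical_run p \<beta> by (rule run) fact
    note agree = limits_agree[OF run[OF assms(2)] run[OF \<beta>]]
      limits_agree[OF run[OF \<beta>] run[OF assms(2)]]
    have u: "u_of p \<beta> = u"
    proof (rule antisym)
      show "u_of p \<beta> \<le> u"
        by (rule enat_le_by_finite) (rule agree(2)[THEN conjunct1])
      show "u \<le> u_of p \<beta>"
        by (rule enat_le_by_finite) (rule agree(1)[THEN conjunct1])
    qed
    \<comment> \<open>The approximation enters the union only through u and the sets L(v) with v <=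
      u, and on these the two runs agree.\<close>
    show ?thesis
      unfolding final_theses_eq[OF surj] b.final_theses_eq[OF surj] u
      by (simp add: agree(1) del: L.simps)
  qed
  then show ?thesis
    using final_theses_L[OF _ surj] final_theses_empty[OF _ surj] H_L_infinity[OF _ surj] by auto
qed

end
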